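(* Let $A$ be a finitely generated (discrete) abelian group, let $\mathbf{K}_1,\dots,\mathbf{K}_m$ be local fields, each with an action of $A$ by scalar multiplication (each element of $A$ acts on $\mathbf{K}_i$ as multiplication by an element of $\mathbf{K}_i^*$), and let $G=\big(\bigoplus_{i=1}^m\mathbf{K}_i\big)\rtimes A$ be the corresponding semidirect product. Assume that for every $i$ there exists an element of $A$ acting on $\mathbf{K}_i$ by contractions, i.e. by multiplication by an element of norm $<1$. Fix a multiplicative norm on each $\mathbf{K}_i$, let $S_i$ be the closed unit ball of $\mathbf{K}_i$, let $T$ be a finite symmetric generating set of $A$, and let $S=T\cup\bigcup_{i=1}^m S_i$. Let $\mathcal{F}$ be the set of words in $S$ of the form $$\left(\prod_{i=1}^m t_iv_it_i^{-1}\right)t,$$ where $v_i\in S_i$ (a single letter) and $t_1,\dots,t_m,t$ are words in the letters of $T$. Then $\mathcal{F}$ is efficient.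
   Context: A local field is a non-discrete locally compact normed field. $|w|_S$ denotes the length of the word $w$ in the letters of $S$. A set $\mathcal{F}$ of words in $S$ is called efficient if there exists a constant $C$ such that for every word $w$ in $S$ there exists $w'\in\mathcal{F}$ representing the same element of $G$ as $w$ and satisfying $|w'|_S\le C|w|_S$.
   Formalization: In the definition of efficient, w ranges over nonempty words only: for the empty word the bound |w'| ≤ C|w| = 0 would force the empty word into F, which is impossible for m ≥ 1 since every word of F contains the m letters v_i. *)

theory Defs
  imports "HOL-Algebra.Ring" "HOL-Algebra.Product_Groups" "HOL-Analysis.Abstract_Metric_Spaces"
begin

section \<open>Local fields\<close>

locale multiplicatively_normed_field = field R for R (structure) +
  fixes nrm :: "'a \<Rightarrow> real"
  assumes nrm_nonneg: "x \<in> carrier R \<Longrightarrow> 0 \<le> nrm x"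
    and nrm_eq_0_iff: "x \<in> carrier R \<Longrightarrow> nrm x = 0 \<longleftrightarrow> x = \<zero>"
    and nrm_mult: "\<lbrakk>x \<in> carrier R; y \<in> carrier R\<rbrakk> \<Longrightarrow> nrm (x \<otimes> y) = nrm x * nrm y"
    and nrm_triangle: "\<lbrakk>x \<in> carrier R; y \<in> carrier R\<rbrakk> \<Longrightarrow> nrm (x \<oplus> y) \<le> nrm x + nrm y"

text \<open>The value \<open>0\<close> off the carrier is immaterial for the topology; it is needed because the
  locale \<open>Metric_space\<close> requires nonnegativity and symmetry on the whole type.\<close>

definition nrm_dist :: "('a, 'b) ring_scheme \<Rightarrow> ('a \<Rightarrow> real) \<Rightarrow> 'a \<Rightarrow> 'a \<Rightarrow> real" where
  "nrm_dist R nrm x y =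
     (if x \<in> carrier R \<and> y \<in> carrier R then nrm (x \<ominus>\<^bsub>R\<^esub> y) else 0)"

definition nrm_topology :: "('a, 'b) ring_scheme \<Rightarrow> ('a \<Rightarrow> real) \<Rightarrow> 'a topology" where
  "nrm_topology R nrm = Metric_space.mtopology (carrier R) (nrm_dist R nrm)"

lemma (in multiplicatively_normed_field) Metric_space_nrm_dist:
  "Metric_space (carrier R) (nrm_dist R nrm)"
proof
  have one: "nrm \<one> = 1"
    using nrm_mult[of \<one> \<one>] nrm_eq_0_iff[of \<one>] one_not_zero by simp
  have "nrm (\<ominus> \<one>) * nrm (\<ominus> \<one>) = 1"
    using nrm_mult[of "\<ominus> \<one>" "\<ominus> \<one>"] one by (simp add: l_minus)
  then have minus_one: "nrm (\<ominus> \<one>) = 1"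
    using nrm_nonneg[of "\<ominus> \<one>"] by (simp add: square_eq_1_iff)
  have minus: "nrm (\<ominus> x) = nrm x" if "x \<in> carrier R" for x
    using that nrm_mult[of "\<ominus> \<one>" x] minus_one by (simp add: l_minus)
  fix x y z
  show "0 \<le> nrm_dist R nrm x y"
    by (simp add: nrm_dist_def nrm_nonneg)
  show "nrm_dist R nrm x y = nrm_dist R nrm y x"
    using minus[of "x \<ominus> y"] by (auto simp: nrm_dist_def a_minus_def minus_add a_comm)
  show "nrm_dist R nrm x y = 0 \<longleftrightarrow> x = y" if "x \<in> carrier R" "y \<in> carrier R"
  proof -
    have "(x \<ominus> y) \<oplus> y = x"
      using that by (simp add: a_minus_def a_assoc l_neg)
    then have "x \<ominus> y = \<zero> \<longleftrightarrow> x = y"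
      using that by (auto simp: a_minus_def r_neg)
    then show ?thesis
      using that by (simp add: nrm_dist_def nrm_eq_0_iff)
  qed
  show "nrm_dist R nrm x z \<le> nrm_dist R nrm x y + nrm_dist R nrm y z"
    if "x \<in> carrier R" "y \<in> carrier R" "z \<in> carrier R"
  proof -
    have "x \<ominus> z = (x \<ominus> y) \<oplus> (y \<ominus> z)"
      using that by (simp add: a_minus_def a_assoc r_neg1)
    then show ?thesis
      using that nrm_triangle[of "x \<ominus> y" "y \<ominus> z"] by (simp add: nrm_dist_def)
  qed
qed

locale local_field = multiplicatively_normed_field +
  assumes locally_compact: "locally_compact_space (nrm_topology R nrm)"
    and non_discrete: "nrm_topology R nrm \<noteq> discrete_topology (carrier R)"

definition unit_ball :: "('a, 'b) ring_scheme \<Rightarrow> ('a \<Rightarrow> real) \<Rightarrow> 'a set" where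
  "unit_ball R nrm = {x \<in> carrier R. nrm x \<le> 1}"

section \<open>Words and efficient sets of words\<close>

text \<open>A word in \<open>S\<close> is a list in \<open>lists S\<close>.\<close>

definition word_val :: "('g, 'b) monoid_scheme \<Rightarrow> 'g list \<Rightarrow> 'g" where
  "word_val G w = foldr (\<otimes>\<^bsub>G\<^esub>) w \<one>\<^bsub>G\<^esub>"

definition inv_word :: "('g, 'b) monoid_scheme \<Rightarrow> 'g list \<Rightarrow> 'g list" where
  "inv_word G w = rev (map (\<lambda>g. inv\<^bsub>G\<^esub> g) w)"

text \<open>The words \<open>w\<close> to be approximated are nonempty: since \<open>length [] = 0\<close>, the inequality for
  \<open>w = []\<close> would force the empty word to belong to \<open>F\<close>. The identity of \<open>G\<close> is still covered,
  through the nonempty words that represent it.\<close>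

definition efficient :: "('g, 'b) monoid_scheme \<Rightarrow> 'g set \<Rightarrow> 'g list set \<Rightarrow> bool" where
  "efficient G S F \<longleftrightarrow>
     F \<subseteq> lists S \<and>
     (\<exists>C::real. \<forall>w\<in>lists S. w \<noteq> [] \<longrightarrow>
        (\<exists>w'\<in>F. word_val G w' = word_val G w \<and> real (length w') \<le> C * real (length w)))"

definition symmetric_generating_set :: "('a, 'b) monoid_scheme \<Rightarrow> 'a set \<Rightarrow> bool" where
  "symmetric_generating_set A T \<longleftrightarrow>
     T \<subseteq> carrier A \<and> (\<forall>t\<in>T. inv\<^bsub>A\<^esub> t \<in> T) \<and> generate A T = carrier A"

section \<open>The semidirect product\<close>

definition semidirect_product ::
  "('n, 'b) monoid_scheme \<Rightarrow> ('h, 'c) monoid_scheme \<Rightarrow> ('h \<Rightarrow> 'n \<Rightarrow> 'n) \<Rightarrow> ('n \<times> 'h) monoid" where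
  "semidirect_product N H \<phi> =
     \<lparr>carrier = carrier N \<times> carrier H,
      monoid.mult = (\<lambda>(x, a) (y, b). (x \<otimes>\<^bsub>N\<^esub> \<phi> a y, a \<otimes>\<^bsub>H\<^esub> b)),
      one = (\<one>\<^bsub>N\<^esub>, \<one>\<^bsub>H\<^esub>)\<rparr>"

text \<open>The fields \<open>K i\<close> are structures on subsets of one common type \<open>'k\<close>; they may be pairwise
  non-isomorphic. The element \<open>a\<close> of the acting group multiplies the \<open>i\<close>-th coordinate by
  \<open>\<rho> i a\<close>.\<close>

definition field_sum :: "nat \<Rightarrow> (nat \<Rightarrow> ('k, 'b) ring_scheme) \<Rightarrow> (nat \<Rightarrow> 'k) monoid" where
  "field_sum m K = sum_group {1..m} (\<lambda>i. add_monoid (K i))"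

definition scalar_action ::
  "nat \<Rightarrow> (nat \<Rightarrow> ('k, 'b) ring_scheme) \<Rightarrow> (nat \<Rightarrow> 'a \<Rightarrow> 'k) \<Rightarrow> 'a \<Rightarrow> (nat \<Rightarrow> 'k) \<Rightarrow> nat \<Rightarrow> 'k" where
  "scalar_action m K \<rho> a x = (\<lambda>i\<in>{1..m}. \<rho> i a \<otimes>\<^bsub>K i\<^esub> x i)"

definition field_semidirect ::
  "('a, 'c) monoid_scheme \<Rightarrow> nat \<Rightarrow> (nat \<Rightarrow> ('k, 'b) ring_scheme) \<Rightarrow> (nat \<Rightarrow> 'a \<Rightarrow> 'k)
     \<Rightarrow> ((nat \<Rightarrow> 'k) \<times> 'a) monoid" where
  "field_semidirect A m K \<rho> = semidirect_product (field_sum m K) A (scalar_action m K \<rho>)"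

definition embed_acting ::
  "nat \<Rightarrow> (nat \<Rightarrow> ('k, 'b) ring_scheme) \<Rightarrow> 'a \<Rightarrow> (nat \<Rightarrow> 'k) \<times> 'a" where
  "embed_acting m K a = (\<one>\<^bsub>field_sum m K\<^esub>, a)"

definition embed_field ::
  "('a, 'c) monoid_scheme \<Rightarrow> nat \<Rightarrow> (nat \<Rightarrow> ('k, 'b) ring_scheme) \<Rightarrow> nat \<Rightarrow> 'k
     \<Rightarrow> (nat \<Rightarrow> 'k) \<times> 'a" where
  "embed_field A m K i x = ((\<lambda>j\<in>{1..m}. if j = i then x else \<zero>\<^bsub>K j\<^esub>), \<one>\<^bsub>A\<^esub>)"

lemma group_semidirect_product:
  assumes "group N" "group H"
    and endo: "\<And>a. a \<in> carrier H \<Longrightarrow> \<phi> a \<in> hom N N"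
    and comp: "\<And>a b x. \<lbrakk>a \<in> carrier H; b \<in> carrier H; x \<in> carrier N\<rbrakk>
                 \<Longrightarrow> \<phi> (a \<otimes>\<^bsub>H\<^esub> b) x = \<phi> a (\<phi> b x)"
    and unit: "\<And>x. x \<in> carrier N \<Longrightarrow> \<phi> \<one>\<^bsub>H\<^esub> x = x"
  shows "group (semidirect_product N H \<phi>)"
proof -
  interpret N: group N by fact
  interpret H: group H by fact
  have closed: "\<phi> a x \<in> carrier N" if "a \<in> carrier H" "x \<in> carrier N" for a x
    using endo that by (auto simp: hom_def)
  have mult: "\<phi> a (x \<otimes>\<^bsub>N\<^esub> y) = \<phi> a x \<otimes>\<^bsub>N\<^esub> \<phi> a y"
    if "a \<in> carrier H" "x \<in> carrier N" "y \<in> carrier N" for a x y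
    using endo that by (auto simp: hom_def)
  have one: "\<phi> a \<one>\<^bsub>N\<^esub> = \<one>\<^bsub>N\<^esub>" if "a \<in> carrier H" for a
    using hom_one[OF endo[OF that]] by (simp add: N.is_group)
  show ?thesis
  proof (rule groupI)
    fix p assume "p \<in> carrier (semidirect_product N H \<phi>)"
    then obtain x a where p: "p = (x, a)" "x \<in> carrier N" "a \<in> carrier H"
      by (auto simp: semidirect_product_def)
    let ?q = "(\<phi> (inv\<^bsub>H\<^esub> a) (inv\<^bsub>N\<^esub> x), inv\<^bsub>H\<^esub> a)"
    have "\<phi> (inv\<^bsub>H\<^esub> a) (inv\<^bsub>N\<^esub> x) \<otimes>\<^bsub>N\<^esub> \<phi> (inv\<^bsub>H\<^esub> a) x = \<one>\<^bsub>N\<^esub>"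
      using p mult[of "inv\<^bsub>H\<^esub> a" "inv\<^bsub>N\<^esub> x" x] one by simp
    then show "\<exists>q\<in>carrier (semidirect_product N H \<phi>).
        q \<otimes>\<^bsub>semidirect_product N H \<phi>\<^esub> p = \<one>\<^bsub>semidirect_product N H \<phi>\<^esub>"
      using p closed by (intro bexI[of _ ?q]) (auto simp: semidirect_product_def)
  qed (auto simp: semidirect_product_def closed mult comp unit one N.m_assoc H.m_assoc)
qed

section \<open>The generating set and the set of words\<close>

definition gen_set ::
  "('a, 'c) monoid_scheme \<Rightarrow> nat \<Rightarrow> (nat \<Rightarrow> ('k, 'b) ring_scheme) \<Rightarrow> (nat \<Rightarrow> 'k \<Rightarrow> real) \<Rightarrow> 'a set
     \<Rightarrow> ((nat \<Rightarrow> 'k) \<times> 'a) set" where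
  "gen_set A m K nrm T =
     embed_acting m K ` T \<union> (\<Union>i\<in>{1..m}. embed_field A m K i ` unit_ball (K i) (nrm i))"

definition conj_words ::
  "('a, 'c) monoid_scheme \<Rightarrow> nat \<Rightarrow> (nat \<Rightarrow> ('k, 'b) ring_scheme) \<Rightarrow> (nat \<Rightarrow> 'k \<Rightarrow> real)
     \<Rightarrow> (nat \<Rightarrow> 'a \<Rightarrow> 'k) \<Rightarrow> 'a set \<Rightarrow> ((nat \<Rightarrow> 'k) \<times> 'a) list set" where
  "conj_words A m K nrm \<rho> T =
     {concat (map (\<lambda>i. ts i @ [v i] @ inv_word (field_semidirect A m K \<rho>) (ts i)) [1..<Suc m]) @ t
      | ts v t.
          (\<forall>i\<in>{1..m}. ts i \<in> lists (embed_acting m K ` T)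
                     \<and> v i \<in> embed_field A m K i ` unit_ball (K i) (nrm i))
          \<and> t \<in> lists (embed_acting m K ` T)}"

end

theory Submission
  imports Defs
begin

text \<open>A word \<open>w\<close> of length \<open>n\<close> represents \<open>(x, a)\<close> with \<open>a\<close> the product of the letters of \<open>w\<close> in
  \<open>T\<close> and each \<open>x\<^sub>i\<close> a sum of at most \<open>n\<close> terms, so \<open>x\<^sub>i\<close> has norm at most \<open>n M\<^sup>n\<close>, where \<open>M\<close> bounds
  the scalars by which \<open>T\<close> acts. Some letter \<open>s\<^sub>i\<close> of \<open>T\<close> multiplies \<open>K i\<close> by a scalar of norm \<open>> 1\<close>;
  a power of \<open>s\<^sub>i\<close> whose exponent is linear in \<open>n\<close> expands by \<open>(2M)\<^sup>n \<ge> n M\<^sup>n\<close>, so that \<open>x\<^sub>i\<close> is the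
  conjugate by it of an element of the unit ball.\<close>

section \<open>Words in a monoid\<close>

lemma word_val_Nil [simp]: "word_val G [] = \<one>\<^bsub>G\<^esub>"
  by (simp add: word_val_def)

lemma word_val_Cons [simp]: "word_val G (g # w) = g \<otimes>\<^bsub>G\<^esub> word_val G w"
  by (simp add: word_val_def)

lemma (in monoid) word_val_closed [simp]:
  "set w \<subseteq> carrier G \<Longrightarrow> word_val G w \<in> carrier G"
  by (induction w) auto

lemma (in monoid) word_val_append:
  "set v \<subseteq> carrier G \<Longrightarrow> set w \<subseteq> carrier G \<Longrightarrow> word_val G (v @ w) = word_val G v \<otimes> word_val G w"
  by (induction v) (auto simp: m_assoc)

lemma (in group) set_inv_word: "set w \<subseteq> carrier G \<Longrightarrow> set (inv_word G w) \<subseteq> carrier G"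
  by (auto simp: inv_word_def)

lemma (in group) word_val_inv_word:
  "set w \<subseteq> carrier G \<Longrightarrow> word_val G (inv_word G w) = inv (word_val G w)"
proof (induction w)
  case (Cons g w)
  then have "word_val G (inv_word G (g # w)) = word_val G (inv_word G w) \<otimes> inv g"
    using set_inv_word[of w] by (simp add: inv_word_def word_val_append)
  with Cons show ?case
    by (simp add: inv_mult_group)
qed (simp add: inv_word_def)

lemma length_inv_word [simp]: "length (inv_word G w) = length w"
  by (simp add: inv_word_def)

section \<open>Multiplicative norms\<close>

context multiplicatively_normed_field
begin

lemma nrm_one [simp]: "nrm \<one> = 1"
  using nrm_mult[of \<one> \<one>] nrm_eq_0_iff[of \<one>] one_not_zero by simp

lemma nrm_zero [simp]: "nrm \<zero> = 0"
  using nrm_eq_0_iff[of \<zero>] by simp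

lemma nrm_m_inv:
  assumes "r \<in> Units R"
  shows "nrm r * nrm (inv r) = 1"
  using assms nrm_mult[of r "inv r"] by (simp add: Units_closed)

lemma nrm_unit_pos:
  assumes "r \<in> Units R"
  shows "0 < nrm r"
  using nrm_m_inv[OF assms] nrm_nonneg[of r] assms
  by (cases "nrm r = 0") (auto simp: Units_closed less_le)

lemma exists_expanding_generator:
  assumes "group A" and f: "f \<in> hom A (units_of R)"
    and T: "symmetric_generating_set A T"
    and a: "a \<in> carrier A" "nrm (f a) < 1"
  shows "\<exists>t\<in>T. 1 < nrm (f t)"
proof (rule ccontr)
  interpret A: group A by fact
  interpret f: group_hom A "units_of R" f
    using f by (simp add: group_hom_def group_hom_axioms_def A.is_group units_group)
  assume "\<not> ?thesis"
  then have le: "nrm (f t) \<le> 1" if "t \<in> T" for t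
    using that by force
  have unit: "f b \<in> Units R" if "b \<in> carrier A" for b
    using f.hom_closed[OF that] by (simp add: units_of_carrier)
  have inverse: "nrm (f b) * nrm (f (inv\<^bsub>A\<^esub> b)) = 1" if "b \<in> carrier A" for b
    using nrm_m_inv[OF unit[OF that]] f.hom_inv[OF that] unit[OF that] by (simp add: units_of_inv)
  have TA: "T \<subseteq> carrier A"
    using T by (simp add: symmetric_generating_set_def)
  have one: "nrm (f t) = 1" if "t \<in> T" for t
  proof -
    have t: "t \<in> carrier A" "inv\<^bsub>A\<^esub> t \<in> T"
      using T that by (auto simp: symmetric_generating_set_def)
    have "1 \<le> nrm (f t)"
      using inverse[OF t(1)] le[OF t(2)] nrm_unit_pos[OF unit[OF t(1)]]
      by (metis mult_left_le less_imp_le)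
    with le[OF that] show ?thesis by simp
  qed
  have "nrm (f b) = 1" if "b \<in> generate A T" for b
    using that
  proof induction
    case one
    then show ?case using f.hom_one by (simp add: units_of_one)
  next
    case (inv t)
    then show ?case using inverse[of t] one[of t] TA by auto
  next
    case (eng b c)
    then have "b \<in> carrier A" "c \<in> carrier A"
      using A.generate_in_carrier[OF TA] by auto
    with eng show ?case
      using nrm_mult[of "f b" "f c"] unit by (simp add: units_of_mult Units_closed)
  qed (use one in auto)
  then show False
    using a T by (auto simp: symmetric_generating_set_def)
qed

end

section \<open>The semidirect product\<close>

locale scalar_semidirect = A: group A for A :: "('a, 'c) monoid_scheme" +
  fixes m :: nat
    and K :: "nat \<Rightarrow> ('k, 'b) ring_scheme"
    and nrm :: "nat \<Rightarrow> 'k \<Rightarrow> real"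
    and \<rho> :: "nat \<Rightarrow> 'a \<Rightarrow> 'k"
  assumes normed: "i \<in> {1..m} \<Longrightarrow> multiplicatively_normed_field (K i) (nrm i)"
    and rho_hom: "i \<in> {1..m} \<Longrightarrow> \<rho> i \<in> hom A (units_of (K i))"
begin

abbreviation G where "G \<equiv> field_semidirect A m K \<rho>"
abbreviation V where "V \<equiv> (\<Pi>\<^sub>E i\<in>{1..m}. carrier (K i))"

lemma K_ring: "i \<in> {1..m} \<Longrightarrow> ring (K i)"
  using normed[of i] by (simp add: multiplicatively_normed_field_def field_def domain_def cring_def)

lemmas K_simps = ring.ring_simprules(1,2,5,8,11,12,15,23,25)[OF K_ring]

lemma rho_unit: "i \<in> {1..m} \<Longrightarrow> a \<in> carrier A \<Longrightarrow> \<rho> i a \<in> Units (K i)"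
  using hom_carrier[OF rho_hom[of i]] by (auto simp: units_of_carrier)

lemma rho_closed: "i \<in> {1..m} \<Longrightarrow> a \<in> carrier A \<Longrightarrow> \<rho> i a \<in> carrier (K i)"
  using rho_unit by (auto simp: Units_def)

lemma rho_mult:
  "i \<in> {1..m} \<Longrightarrow> a \<in> carrier A \<Longrightarrow> b \<in> carrier A \<Longrightarrow> \<rho> i (a \<otimes>\<^bsub>A\<^esub> b) = \<rho> i a \<otimes>\<^bsub>K i\<^esub> \<rho> i b"
  using hom_mult[OF rho_hom[of i]] by (simp add: units_of_mult)

lemma rho_one:
  assumes "i \<in> {1..m}"
  shows "\<rho> i \<one>\<^bsub>A\<^esub> = \<one>\<^bsub>K i\<^esub>"
proof -
  interpret ring "K i" by (rule K_ring[OF assms])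
  show ?thesis
    using hom_one[OF rho_hom[OF assms] A.is_group units_group] by (simp add: units_of_one)
qed

lemma nrm_rho_pow:
  assumes "i \<in> {1..m}" "a \<in> carrier A"
  shows "nrm i (\<rho> i (a [^]\<^bsub>A\<^esub> (k::nat))) = nrm i (\<rho> i a) ^ k"
proof -
  interpret multiplicatively_normed_field "K i" "nrm i" by (rule normed[OF assms(1)])
  show ?thesis
    by (induction k) (use assms in \<open>auto simp: rho_one rho_mult nrm_mult rho_closed\<close>)
qed

lemma field_sum_group: "group (field_sum m K)"
  unfolding field_sum_def
proof (rule sum_group)
  fix i assume "i \<in> {1..m}"
  then interpret ring "K i" by (rule K_ring)
  show "group (add_monoid (K i))" by (rule a_group)
qed

lemma field_sum_simps:
  "carrier (field_sum m K) = V"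
  "\<one>\<^bsub>field_sum m K\<^esub> = (\<lambda>i\<in>{1..m}. \<zero>\<^bsub>K i\<^esub>)"
  "x \<otimes>\<^bsub>field_sum m K\<^esub> y = (\<lambda>i\<in>{1..m}. x i \<oplus>\<^bsub>K i\<^esub> y i)"
proof -
  have grp: "group (add_monoid (K i))" if "i \<in> {1..m}" for i
  proof -
    interpret ring "K i" by (rule K_ring[OF that])
    show ?thesis by (rule a_group)
  qed
  show "carrier (field_sum m K) = V"
    unfolding field_sum_def by (subst carrier_sum_group) (auto simp: grp)
qed (simp_all add: field_sum_def)

lemma G_simps:
  "carrier G = V \<times> carrier A"
  "\<one>\<^bsub>G\<^esub> = ((\<lambda>i\<in>{1..m}. \<zero>\<^bsub>K i\<^esub>), \<one>\<^bsub>A\<^esub>)"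
  "(x, a) \<otimes>\<^bsub>G\<^esub> (y, b) = ((\<lambda>i\<in>{1..m}. x i \<oplus>\<^bsub>K i\<^esub> \<rho> i a \<otimes>\<^bsub>K i\<^esub> y i), a \<otimes>\<^bsub>A\<^esub> b)"
  by (auto simp: field_semidirect_def semidirect_product_def field_sum_simps scalar_action_def)

lemma embed_simps:
  "embed_acting m K a = ((\<lambda>i\<in>{1..m}. \<zero>\<^bsub>K i\<^esub>), a)"
  "embed_field A m K i u = ((\<lambda>j\<in>{1..m}. if j = i then u else \<zero>\<^bsub>K j\<^esub>), \<one>\<^bsub>A\<^esub>)"
  by (simp_all add: embed_acting_def embed_field_def field_sum_simps)

lemma G_group: "group G"
  unfolding field_semidirect_def
proof (rule group_semidirect_product[OF field_sum_group A.is_group])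
  fix a b x assume a: "a \<in> carrier A"
  show "scalar_action m K \<rho> a \<in> hom (field_sum m K) (field_sum m K)"
    using a by (auto simp: hom_def field_sum_simps scalar_action_def PiE_iff fun_eq_iff rho_closed
        K_simps restrict_def)
  assume "b \<in> carrier A" "x \<in> carrier (field_sum m K)"
  with a show "scalar_action m K \<rho> (a \<otimes>\<^bsub>A\<^esub> b) x = scalar_action m K \<rho> a (scalar_action m K \<rho> b x)"
    by (auto simp: field_sum_simps scalar_action_def PiE_iff fun_eq_iff rho_closed rho_mult
        K_simps restrict_def)
next
  fix x assume "x \<in> carrier (field_sum m K)"
  then show "scalar_action m K \<rho> \<one>\<^bsub>A\<^esub> x = x"
    by (auto simp: field_sum_simps scalar_action_def PiE_iff fun_eq_iff rho_one extensional_def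
        K_simps restrict_def)
qed

lemma embed_acting_closed: "a \<in> carrier A \<Longrightarrow> embed_acting m K a \<in> carrier G"
  by (auto simp: G_simps embed_simps K_simps)

lemma embed_field_closed: "u \<in> carrier (K i) \<Longrightarrow> embed_field A m K i u \<in> carrier G"
  by (auto simp: G_simps embed_simps K_simps)

lemma embed_acting_mult:
  "a \<in> carrier A \<Longrightarrow> b \<in> carrier A \<Longrightarrow>
    embed_acting m K a \<otimes>\<^bsub>G\<^esub> embed_acting m K b = embed_acting m K (a \<otimes>\<^bsub>A\<^esub> b)"
  by (auto simp: G_simps embed_simps K_simps rho_closed fun_eq_iff)

lemma word_val_embed_replicate:
  assumes "s \<in> carrier A"
  shows "word_val G (replicate k (embed_acting m K s)) = embed_acting m K (s [^]\<^bsub>A\<^esub> k)"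
proof (induction k)
  case 0
  then show ?case by (simp add: G_simps embed_simps)
next
  case (Suc k)
  then show ?case
    using assms by (simp add: embed_acting_mult A.nat_pow_comm[of s 1 k, simplified])
qed

lemma conj_embed_field:
  assumes "i \<in> {1..m}" "a \<in> carrier A" "u \<in> carrier (K i)"
  shows "embed_acting m K a \<otimes>\<^bsub>G\<^esub> (embed_field A m K i u \<otimes>\<^bsub>G\<^esub> inv\<^bsub>G\<^esub> (embed_acting m K a))
    = embed_field A m K i (\<rho> i a \<otimes>\<^bsub>K i\<^esub> u)"
proof -
  interpret G: group G by (rule G_group)
  have r: "\<rho> i a \<otimes>\<^bsub>K i\<^esub> u \<in> carrier (K i)"
    using assms by (simp add: rho_closed K_simps)
  have "embed_acting m K a \<otimes>\<^bsub>G\<^esub> embed_field A m K i u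
      = embed_field A m K i (\<rho> i a \<otimes>\<^bsub>K i\<^esub> u) \<otimes>\<^bsub>G\<^esub> embed_acting m K a"
    using assms r by (auto simp: G_simps embed_simps rho_closed K_simps fun_eq_iff)
  then have "embed_acting m K a \<otimes>\<^bsub>G\<^esub> embed_field A m K i u \<otimes>\<^bsub>G\<^esub> inv\<^bsub>G\<^esub> (embed_acting m K a)
      = embed_field A m K i (\<rho> i a \<otimes>\<^bsub>K i\<^esub> u)"
    using G.inv_solve_right'[of "embed_field A m K i (\<rho> i a \<otimes>\<^bsub>K i\<^esub> u)"] assms r
    by (simp add: embed_acting_closed embed_field_closed G.m_assoc)
  then show ?thesis
    using assms by (simp add: embed_acting_closed embed_field_closed G.m_assoc)
qed

lemma word_val_conj_word:
  fixes k :: nat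
  assumes "i \<in> {1..m}" "s \<in> carrier A" "u \<in> carrier (K i)"
  defines "p \<equiv> replicate k (embed_acting m K s)"
  shows "word_val G (p @ [embed_field A m K i u] @ inv_word G p)
    = embed_field A m K i (\<rho> i (s [^]\<^bsub>A\<^esub> k) \<otimes>\<^bsub>K i\<^esub> u)"
    and "set (p @ [embed_field A m K i u] @ inv_word G p) \<subseteq> carrier G"
proof -
  interpret G: group G by (rule G_group)
  have p: "set p \<subseteq> carrier G"
    using assms by (auto simp: embed_acting_closed)
  show "set (p @ [embed_field A m K i u] @ inv_word G p) \<subseteq> carrier G"
    using p G.set_inv_word[OF p] embed_field_closed assms by auto
  show "word_val G (p @ [embed_field A m K i u] @ inv_word G p)
    = embed_field A m K i (\<rho> i (s [^]\<^bsub>A\<^esub> k) \<otimes>\<^bsub>K i\<^esub> u)"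
    using p G.set_inv_word[OF p] embed_field_closed assms
    by (simp add: G.word_val_append G.word_val_inv_word word_val_embed_replicate conj_embed_field)
qed

lemma word_val_concat_embed_field:
  assumes "x \<in> V" "j \<le> m"
    and "\<And>i. i \<in> {1..m} \<Longrightarrow> set (f i) \<subseteq> carrier G"
    and "\<And>i. i \<in> {1..m} \<Longrightarrow> word_val G (f i) = embed_field A m K i (x i)"
  shows "word_val G (concat (map f [1..<Suc j]))
    = ((\<lambda>i\<in>{1..m}. if i \<le> j then x i else \<zero>\<^bsub>K i\<^esub>), \<one>\<^bsub>A\<^esub>)"
  using assms(2)
proof (induction j)
  case 0
  then show ?case by (auto simp: G_simps fun_eq_iff)
next
  case (Suc j)
  interpret G: group G by (rule G_group)
  have j: "Suc j \<in> {1..m}"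
    using Suc.prems by simp
  have "word_val G (concat (map f [1..<Suc (Suc j)]))
      = word_val G (concat (map f [1..<Suc j])) \<otimes>\<^bsub>G\<^esub> word_val G (f (Suc j))"
    using Suc.prems assms(3) by (subst G.word_val_append[symmetric]) (force+)
  also have "\<dots> = ((\<lambda>i\<in>{1..m}. if i \<le> j then x i else \<zero>\<^bsub>K i\<^esub>), \<one>\<^bsub>A\<^esub>)
      \<otimes>\<^bsub>G\<^esub> embed_field A m K (Suc j) (x (Suc j))"
    by (simp only: Suc.IH[OF Suc_leD[OF Suc.prems]] assms(4)[OF j])
  also have "\<dots> = ((\<lambda>i\<in>{1..m}. if i \<le> Suc j then x i else \<zero>\<^bsub>K i\<^esub>), \<one>\<^bsub>A\<^esub>)"
  proof -
    have "(if i \<le> j then x i else \<zero>\<^bsub>K i\<^esub>) \<oplus>\<^bsub>K i\<^esub>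
        \<rho> i \<one>\<^bsub>A\<^esub> \<otimes>\<^bsub>K i\<^esub> (if i = Suc j then x (Suc j) else \<zero>\<^bsub>K i\<^esub>)
        = (if i \<le> Suc j then x i else \<zero>\<^bsub>K i\<^esub>)" if i: "i \<in> {1..m}" for i
    proof -
      have "x i \<in> carrier (K i)"
        using assms(1) i by auto
      then show ?thesis
        using i rho_one[OF i] by (cases "i = Suc j") (auto simp: le_Suc_eq K_simps)
    qed
    then show ?thesis
      by (simp add: G_simps embed_simps cong: restrict_cong)
  qed
  finally show ?case .
qed

lemma word_val_bound:
  assumes "T \<subseteq> carrier A" "w \<in> lists (gen_set A m K nrm T)"
    and M: "\<And>i. i \<in> {1..m} \<Longrightarrow> 1 \<le> M i"
      "\<And>i t. i \<in> {1..m} \<Longrightarrow> t \<in> T \<Longrightarrow> nrm i (\<rho> i t) \<le> M i"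
  shows "\<exists>x a. word_val G w = (x, a) \<and> x \<in> V
    \<and> (\<forall>i\<in>{1..m}. nrm i (x i) \<le> real (length w) * M i ^ length w)
    \<and> (\<exists>t\<in>lists (embed_acting m K ` T). length t \<le> length w
         \<and> a \<in> carrier A \<and> word_val G t = embed_acting m K a)"
  using assms(2)
proof induction
  case Nil
  show ?case
    by (rule exI[of _ "\<lambda>i\<in>{1..m}. \<zero>\<^bsub>K i\<^esub>"], rule exI[of _ "\<one>\<^bsub>A\<^esub>"])
      (auto simp: G_simps embed_simps K_simps
        multiplicatively_normed_field.nrm_zero[OF normed])
next
  case (Cons g w)
  then obtain x a t where w: "word_val G w = (x, a)" "x \<in> V" "a \<in> carrier A"
      "\<And>i. i \<in> {1..m} \<Longrightarrow> nrm i (x i) \<le> real (length w) * M i ^ length w"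
    and t: "t \<in> lists (embed_acting m K ` T)" "length t \<le> length w"
      "word_val G t = embed_acting m K a"
    by blast
  have x: "x i \<in> carrier (K i)" if "i \<in> {1..m}" for i
    using w(2) that by auto
  consider b where "b \<in> T" "g = embed_acting m K b"
    | j u where "j \<in> {1..m}" "u \<in> unit_ball (K j) (nrm j)" "g = embed_field A m K j u"
    using Cons.hyps by (auto simp: gen_set_def)
  then show ?case
  proof cases
    case 1
    then have b: "b \<in> carrier A"
      using assms(1) by auto
    let ?y = "\<lambda>i\<in>{1..m}. \<rho> i b \<otimes>\<^bsub>K i\<^esub> x i"
    have val: "word_val G (g # w) = (?y, b \<otimes>\<^bsub>A\<^esub> a)"
      using 1 b x by (simp add: w(1) G_simps embed_simps K_simps rho_closed
          cong: restrict_cong)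
    have bound: "nrm i (?y i) \<le> real (length (g # w)) * M i ^ length (g # w)" if i: "i \<in> {1..m}" for i
    proof -
      interpret multiplicatively_normed_field "K i" "nrm i" by (rule normed[OF i])
      have "nrm i (?y i) = nrm i (\<rho> i b) * nrm i (x i)"
        using i b x by (simp add: nrm_mult rho_closed)
      also have "\<dots> \<le> M i * (real (length w) * M i ^ length w)"
        using M[OF i] w(4)[OF i] nrm_nonneg[OF x[OF i]] 1 by (intro mult_mono) auto
      also have "\<dots> \<le> real (length (g # w)) * M i ^ length (g # w)"
        using M(1)[OF i] by (simp add: algebra_simps)
      finally show ?thesis .
    qed
    have "?y \<in> V"
      using b x by (auto simp: K_simps rho_closed)
    moreover have "embed_acting m K b # t \<in> lists (embed_acting m K ` T)"
      using 1 t by simp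
    moreover have "word_val G (embed_acting m K b # t) = embed_acting m K (b \<otimes>\<^bsub>A\<^esub> a)"
      using t b w by (simp add: embed_acting_mult)
    moreover have "length (embed_acting m K b # t) \<le> length (g # w)"
      using t by simp
    ultimately show ?thesis
      using val bound A.m_closed[OF b w(3)]
      by (intro exI[of _ ?y] exI[of _ "b \<otimes>\<^bsub>A\<^esub> a"] conjI ballI
          bexI[of _ "embed_acting m K b # t"])
  next
    case 2
    then have u: "u \<in> carrier (K j)" "nrm j u \<le> 1"
      by (auto simp: unit_ball_def)
    let ?y = "\<lambda>i\<in>{1..m}. (if i = j then u else \<zero>\<^bsub>K i\<^esub>) \<oplus>\<^bsub>K i\<^esub> x i"
    have val: "word_val G (g # w) = (?y, a)"
      using 2 w x by (simp add: G_simps embed_simps K_simps rho_one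
          cong: restrict_cong)
    have bound: "nrm i (?y i) \<le> real (length (g # w)) * M i ^ length (g # w)" if i: "i \<in> {1..m}" for i
    proof -
      interpret multiplicatively_normed_field "K i" "nrm i" by (rule normed[OF i])
      have "(if i = j then u else \<zero>\<^bsub>K i\<^esub>) \<in> carrier (K i)"
        using u by simp
      then have "nrm i (?y i) \<le> nrm i (if i = j then u else \<zero>\<^bsub>K i\<^esub>) + nrm i (x i)"
        using nrm_triangle[OF _ x[OF i]] i by simp
      also have "\<dots> \<le> 1 + real (length w) * M i ^ length w"
        using u w(4)[OF i] by (auto simp: add_mono)
      also have "\<dots> \<le> M i ^ length (g # w) + real (length w) * M i ^ length (g # w)"
        using M(1)[OF i] by (intro add_mono one_le_power mult_left_mono power_increasing) auto
      also have "\<dots> = real (length (g # w)) * M i ^ length (g # w)"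
        by (simp add: algebra_simps)
      finally show ?thesis .
    qed
    have "?y \<in> V"
      using u x by (auto simp: K_simps)
    moreover have "length t \<le> length (g # w)"
      using t by simp
    ultimately show ?thesis
      using val bound t w(3)
      by (intro exI[of _ ?y] exI[of _ a] conjI ballI bexI[of _ t])
  qed
qed

lemma conj_words_subset:
  assumes "symmetric_generating_set A T"
  shows "conj_words A m K nrm \<rho> T \<subseteq> lists (gen_set A m K nrm T)"
proof -
  interpret G: group G by (rule G_group)
  have "inv\<^bsub>G\<^esub> (embed_acting m K t) = embed_acting m K (inv\<^bsub>A\<^esub> t)" if "t \<in> carrier A" for t
    using that embed_acting_mult[of "inv\<^bsub>A\<^esub> t" t]
    by (intro G.inv_equality) (auto simp: embed_acting_closed, simp add: embed_simps G_simps)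
  then have inv: "inv\<^bsub>G\<^esub> g \<in> embed_acting m K ` T" if "g \<in> embed_acting m K ` T" for g
    using that assms by (auto simp: symmetric_generating_set_def)
  show ?thesis
  proof
    fix w assume "w \<in> conj_words A m K nrm \<rho> T"
    then obtain ts v t where
        w: "w = concat (map (\<lambda>i. ts i @ [v i] @ inv_word G (ts i)) [1..<Suc m]) @ t"
      and ts: "\<And>i. i \<in> {1..m} \<Longrightarrow> set (ts i) \<subseteq> embed_acting m K ` T"
      and v: "\<And>i. i \<in> {1..m} \<Longrightarrow> v i \<in> embed_field A m K i ` unit_ball (K i) (nrm i)"
      and t: "set t \<subseteq> embed_acting m K ` T"
      unfolding conj_words_def in_lists_conv_set by blast
    have acting: "embed_acting m K ` T \<subseteq> gen_set A m K nrm T"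
      by (simp add: gen_set_def)
    have "set (ts i @ [v i] @ inv_word G (ts i)) \<subseteq> gen_set A m K nrm T" if i: "i \<in> {1..m}" for i
    proof -
      have "set (inv_word G (ts i)) \<subseteq> embed_acting m K ` T"
        using ts[OF i] inv unfolding inv_word_def set_rev set_map by blast
      moreover have "v i \<in> gen_set A m K nrm T"
        unfolding gen_set_def using i v[OF i] by (intro UnI2 UN_I)
      ultimately show ?thesis
        using subset_trans[OF ts[OF i] acting] subset_trans[OF _ acting] by simp
    qed
    then have "(\<Union>i\<in>{1..m}. set (ts i @ [v i] @ inv_word G (ts i))) \<subseteq> gen_set A m K nrm T"
      by (rule UN_least)
    moreover have "set t \<subseteq> gen_set A m K nrm T"
      using t acting by (rule subset_trans)
    moreover have "set w = (\<Union>i\<in>{1..m}. set (ts i @ [v i] @ inv_word G (ts i))) \<union> set t"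
      by (simp add: w atLeastLessThanSuc_atLeastAtMost del: upt_Suc)
    ultimately show "w \<in> lists (gen_set A m K nrm T)"
      by (simp only: lists_eq_set mem_Collect_eq Un_least)
  qed
qed

lemma exists_conj_word:
  assumes T: "T \<subseteq> carrier A" and x: "x \<in> V" and a: "a \<in> carrier A"
    and s: "\<And>i. i \<in> {1..m} \<Longrightarrow> s i \<in> T"
    and k: "\<And>i. i \<in> {1..m} \<Longrightarrow> nrm i (x i) \<le> nrm i (\<rho> i (s i)) ^ k i"
    and t: "t \<in> lists (embed_acting m K ` T)" "word_val G t = embed_acting m K a"
  shows "\<exists>w\<in>conj_words A m K nrm \<rho> T. word_val G w = (x, a)
    \<and> length w = (\<Sum>i=1..m. 2 * k i + 1) + length t"
proof -
  interpret G: group G by (rule G_group)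
  define r where "r i = \<rho> i (s i [^]\<^bsub>A\<^esub> k i)" for i
  define u where "u i = inv\<^bsub>K i\<^esub> (r i) \<otimes>\<^bsub>K i\<^esub> x i" for i
  define p where "p i = replicate (k i) (embed_acting m K (s i))" for i
  define f where "f = (\<lambda>i. p i @ [embed_field A m K i (u i)] @ inv_word G (p i))"
  have sA: "s i \<in> carrier A" if "i \<in> {1..m}" for i
    using s[OF that] T by auto
  have u: "u i \<in> unit_ball (K i) (nrm i)" "r i \<otimes>\<^bsub>K i\<^esub> u i = x i" if i: "i \<in> {1..m}" for i
  proof -
    interpret multiplicatively_normed_field "K i" "nrm i" by (rule normed[OF i])
    have r: "r i \<in> Units (K i)"
      using i sA by (simp add: r_def rho_unit)
    have xi: "x i \<in> carrier (K i)"
      using x i by auto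
    have "nrm i (x i) \<le> nrm i (r i)"
      using k[OF i] nrm_rho_pow[OF i sA[OF i]] by (simp add: r_def)
    then have "nrm i (x i) * nrm i (inv\<^bsub>K i\<^esub> (r i)) \<le> nrm i (r i) * nrm i (inv\<^bsub>K i\<^esub> (r i))"
      using r by (intro mult_right_mono) (auto simp: nrm_nonneg)
    then have "nrm i (u i) \<le> 1"
      using r xi nrm_m_inv[OF r] by (simp add: u_def nrm_mult mult.commute)
    with r xi show "u i \<in> unit_ball (K i) (nrm i)"
      by (simp add: unit_ball_def u_def)
    show "r i \<otimes>\<^bsub>K i\<^esub> u i = x i"
      using r xi by (simp add: u_def m_assoc[symmetric] Units_closed)
  qed
  have f: "word_val G (f i) = embed_field A m K i (x i)" "set (f i) \<subseteq> carrier G" if i: "i \<in> {1..m}" for i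
    using word_val_conj_word[OF i sA[OF i], of "u i" "k i"] u[OF i]
    by (simp_all add: f_def p_def r_def unit_ball_def)
  let ?c = "concat (map f [1..<Suc m])"
  have "(\<lambda>i\<in>{1..m}. if i \<le> m then x i else \<zero>\<^bsub>K i\<^esub>) = x"
    using x by (auto simp: fun_eq_iff PiE_iff extensional_def)
  then have c: "word_val G ?c = (x, \<one>\<^bsub>A\<^esub>)"
    using word_val_concat_embed_field[OF x order_refl f(2) f(1)] by (simp only:)
  have "embed_acting m K ` T \<subseteq> carrier G"
    using T embed_acting_closed by blast
  then have tG: "set t \<subseteq> carrier G"
    using t(1) by (simp add: lists_eq_set)
  have "set [1..<Suc m] = {1..m}"
    by (simp add: atLeastLessThanSuc_atLeastAtMost del: upt_Suc)
  then have "set ?c \<subseteq> carrier G"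
    unfolding set_concat set_map using f(2) by blast
  then have "word_val G (?c @ t) = (x, \<one>\<^bsub>A\<^esub>) \<otimes>\<^bsub>G\<^esub> embed_acting m K a"
    using tG by (simp only: G.word_val_append c t(2))
  also have "\<dots> = ((\<lambda>i\<in>{1..m}. x i), a)"
    using x a by (simp add: G_simps embed_simps rho_one K_simps PiE_mem[OF x] cong: restrict_cong)
  also have "(\<lambda>i\<in>{1..m}. x i) = x"
    using x by (rule PiE_restrict)
  finally have "word_val G (?c @ t) = (x, a)" .
  moreover have "length ?c = (\<Sum>i=1..m. 2 * k i + 1)"
    by (simp add: length_concat comp_def f_def p_def interv_sum_list_conv_sum_set_nat
        atLeastLessThanSuc_atLeastAtMost mult_2 del: upt_Suc)
  moreover have "?c @ t \<in> conj_words A m K nrm \<rho> T"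
  proof -
    have "p i \<in> lists (embed_acting m K ` T)
        \<and> embed_field A m K i (u i) \<in> embed_field A m K i ` unit_ball (K i) (nrm i)"
      if "i \<in> {1..m}" for i
      using s[OF that] u(1)[OF that] by (auto simp: p_def)
    with t(1) show ?thesis
      unfolding conj_words_def f_def mem_Collect_eq
      by (intro exI[of _ p] exI[of _ "\<lambda>i. embed_field A m K i (u i)"] exI[of _ t] conjI ballI refl)
        simp_all
  qed
  ultimately show ?thesis
    by (intro bexI[of _ "?c @ t"] conjI) (simp_all only: length_append)
qed

end

theorem lemma5p1:
  fixes A :: "('a, 'c) monoid_scheme"
    and m :: nat
    and K :: "nat \<Rightarrow> ('k, 'b) ring_scheme"
    and nrm :: "nat \<Rightarrow> 'k \<Rightarrow> real"
    and \<rho> :: "nat \<Rightarrow> 'a \<Rightarrow> 'k"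
    and T :: "'a set"
  assumes "comm_group A"
    and "\<And>i. i \<in> {1..m} \<Longrightarrow> local_field (K i) (nrm i)"
    and "\<And>i. i \<in> {1..m} \<Longrightarrow> \<rho> i \<in> hom A (units_of (K i))"
    and "\<And>i. i \<in> {1..m} \<Longrightarrow> \<exists>a\<in>carrier A. nrm i (\<rho> i a) < 1"
    and "finite T"
    and "symmetric_generating_set A T"
  shows "efficient (field_semidirect A m K \<rho>) (gen_set A m K nrm T) (conj_words A m K nrm \<rho> T)"
proof -
  interpret scalar_semidirect A m K nrm \<rho>
    by (intro scalar_semidirect.intro scalar_semidirect_axioms.intro comm_group.axioms(2)[OF assms(1)]
        local_field.axioms(1)[OF assms(2)] assms(3))
  have T: "T \<subseteq> carrier A"
    using assms(6) by (simp add: symmetric_generating_set_def)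
  define M where "M i = 1 + (\<Sum>t\<in>T. nrm i (\<rho> i t))" for i
  have nonneg: "0 \<le> nrm i (\<rho> i t)" if "i \<in> {1..m}" "t \<in> T" for i t
    using that T by (intro multiplicatively_normed_field.nrm_nonneg[OF normed] rho_closed) auto
  have M1: "1 \<le> M i" if "i \<in> {1..m}" for i
    using nonneg[OF that] by (simp add: M_def sum_nonneg)
  have M: "nrm i (\<rho> i t) \<le> M i" if "i \<in> {1..m}" "t \<in> T" for i t
    using member_le_sum[of t T "\<lambda>t. nrm i (\<rho> i t)"] nonneg that assms(5) by (force simp: M_def)
  have "\<exists>s\<in>T. \<exists>c::nat. 2 * M i \<le> nrm i (\<rho> i s) ^ c" if i: "i \<in> {1..m}" for i
  proof -
    obtain s where "s \<in> T" "1 < nrm i (\<rho> i s)"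
      using multiplicatively_normed_field.exists_expanding_generator[OF normed[OF i] A.is_group
          rho_hom[OF i] assms(6)] assms(4)[OF i] by blast
    moreover from this obtain c where "2 * M i < nrm i (\<rho> i s) ^ c"
      using real_arch_pow by blast
    ultimately show ?thesis
      by (meson less_imp_le)
  qed
  then obtain s c where s: "\<And>i. i \<in> {1..m} \<Longrightarrow> s i \<in> T"
    and c: "\<And>i. i \<in> {1..m} \<Longrightarrow> 2 * M i \<le> nrm i (\<rho> i (s i)) ^ c i"
    by metis
  define C where "C = (\<Sum>i=1..m. 2 * c i + 1) + 1"
  have "\<exists>w'\<in>conj_words A m K nrm \<rho> T. word_val G w' = word_val G w
      \<and> real (length w') \<le> real C * real (length w)"
    if w: "w \<in> lists (gen_set A m K nrm T)" "w \<noteq> []" for w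
  proof -
    let ?n = "length w"
    have n: "1 \<le> ?n"
      using w(2) by (simp add: Suc_le_eq)
    obtain x a t where x: "word_val G w = (x, a)" "x \<in> V" "a \<in> carrier A"
        "\<And>i. i \<in> {1..m} \<Longrightarrow> nrm i (x i) \<le> real ?n * M i ^ ?n"
      and t: "t \<in> lists (embed_acting m K ` T)" "length t \<le> ?n" "word_val G t = embed_acting m K a"
      using word_val_bound[OF T w(1) M1 M] by blast
    have k: "nrm i (x i) \<le> nrm i (\<rho> i (s i)) ^ (c i * ?n)" if i: "i \<in> {1..m}" for i
    proof -
      have "real ?n \<le> 2 ^ ?n"
        by (simp add: less_imp_le)
      then have "real ?n * M i ^ ?n \<le> (2 * M i) ^ ?n"
        using M1[OF i] by (simp add: power_mult_distrib mult_right_mono)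
      also have "\<dots> \<le> (nrm i (\<rho> i (s i)) ^ c i) ^ ?n"
        using c[OF i] M1[OF i] by (intro power_mono) auto
      finally show ?thesis
        using x(4)[OF i] by (simp add: power_mult)
    qed
    obtain w' where w': "w' \<in> conj_words A m K nrm \<rho> T" "word_val G w' = (x, a)"
        "length w' = (\<Sum>i=1..m. 2 * (c i * ?n) + 1) + length t"
      using exists_conj_word[OF T x(2,3) s k t(1,3)] by blast
    have "(\<Sum>i=1..m. 2 * (c i * ?n) + 1) \<le> (\<Sum>i=1..m. 2 * c i + 1) * ?n"
      unfolding sum_distrib_right using n by (intro sum_mono) (simp add: algebra_simps)
    then have "length w' \<le> C * ?n"
      using w'(3) t(2) by (simp only: C_def add_mult_distrib mult_1 add_mono)
    then show ?thesis
      using w' x(1) by (metis of_nat_le_iff of_nat_mult)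
  qed
  then show ?thesis
    using conj_words_subset[OF assms(6)] unfolding efficient_def by blast
qed

end
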